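(* For any integer $N\ge 3$ and any $$\theta\in\left(\tfrac12,\tfrac{N-1}{N}\right),$$ there exist a convex set $\Omega\subset\mathbb{R}^N$ (a nonempty convex domain) and a non-quadratic, locally uniformly convex solution $u\in C^5(\Omega)$ of $$D_{ij}(U^{ij}w)=0\quad\text{in }\Omega,\qquad w=[\det D^2u]^{-\theta},$$ satisfying $$\lim_{x\to\partial\Omega}u(x)=+\infty .$$
   Context: Repeated indices are summed. $[U^{ij}]$ is the cofactor matrix of the Hessian $D^2u=[u_{ij}]$. Since $D_jU^{ij}=0$, the equation is equivalent to $u^{ij}D_{ij}w=0$, where $[u^{ij}]$ is the inverse of $[u_{ij}]$. "Locally uniformly convex" means that $D^2u$ is positive definite at every point of $\Omega$. "Non-quadratic" means that $u$ is not a polynomial of degree at most two. The condition $\lim_{x\to\partial\Omega}u(x)=+\infty$ means that $u(x)\to+\infty$ as $x\in\Omega$ tends to any boundary point of $\Omega$. *)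

theory Defs
  imports "HOL-Analysis.Analysis"
begin

definition partial :: "'n::finite \<Rightarrow> (real ^ 'n \<Rightarrow> real) \<Rightarrow> real ^ 'n \<Rightarrow> real" where
  "partial i f x = deriv (\<lambda>t. f (x + t *\<^sub>R axis i 1)) 0"

definition has_partials_on :: "(real ^ 'n::finite \<Rightarrow> real) \<Rightarrow> (real ^ 'n) set \<Rightarrow> bool" where
  "has_partials_on f S \<longleftrightarrow>
     (\<forall>i. \<forall>x\<in>S. (\<lambda>t. f (x + t *\<^sub>R axis i 1)) differentiable (at 0))"

text \<open>The class $C^k(S)$ for open \<open>S\<close>; no extension to the closure is required.\<close>

primrec Ck_on :: "nat \<Rightarrow> (real ^ 'n::finite \<Rightarrow> real) \<Rightarrow> (real ^ 'n) set \<Rightarrow> bool" where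
  "Ck_on 0 f S \<longleftrightarrow> continuous_on S f"
| "Ck_on (Suc k) f S \<longleftrightarrow>
     continuous_on S f \<and> has_partials_on f S \<and> (\<forall>i. Ck_on k (partial i f) S)"

definition hessian :: "(real ^ 'n::finite \<Rightarrow> real) \<Rightarrow> real ^ 'n \<Rightarrow> real ^ 'n ^ 'n" where
  "hessian u x = (\<chi> i j. partial i (partial j u) x)"

text \<open>The index type carries no order, so the signed minor $(-1)^{i+j} M_{ij}$ is expressed as
  the determinant of \<open>A\<close> with row \<open>i\<close> and column \<open>j\<close> cleared except for a \<open>1\<close> at \<open>(i, j)\<close>.\<close>

definition cofactor_matrix :: "real ^ 'n::finite ^ 'n \<Rightarrow> real ^ 'n ^ 'n" where
  "cofactor_matrix A =
     (\<chi> i j. det (\<chi> k l. if k = i \<and> l = j then 1 else if k = i \<or> l = j then 0 else A $ k $ l))"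

definition positive_definite :: "real ^ 'n::finite ^ 'n \<Rightarrow> bool" where
  "positive_definite A \<longleftrightarrow> transpose A = A \<and> (\<forall>v. v \<noteq> 0 \<longrightarrow> 0 < v \<bullet> (A *v v))"

definition locally_uniformly_convex_on ::
  "(real ^ 'n::finite) set \<Rightarrow> (real ^ 'n \<Rightarrow> real) \<Rightarrow> bool" where
  "locally_uniformly_convex_on \<Omega> u \<longleftrightarrow> (\<forall>x\<in>\<Omega>. positive_definite (hessian u x))"

definition quadratic_on :: "(real ^ 'n::finite) set \<Rightarrow> (real ^ 'n \<Rightarrow> real) \<Rightarrow> bool" where
  "quadratic_on \<Omega> u \<longleftrightarrow> (\<exists>(A :: real ^ 'n ^ 'n) b c. \<forall>x\<in>\<Omega>. u x = x \<bullet> (A *v x) + b \<bullet> x + c)"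

definition affine_weight :: "real \<Rightarrow> (real ^ 'n::finite \<Rightarrow> real) \<Rightarrow> real ^ 'n \<Rightarrow> real" where
  "affine_weight \<theta> u x = det (hessian u x) powr (- \<theta>)"

definition affine_maximal_type_on ::
  "real \<Rightarrow> (real ^ 'n::finite) set \<Rightarrow> (real ^ 'n \<Rightarrow> real) \<Rightarrow> bool" where
  "affine_maximal_type_on \<theta> \<Omega> u \<longleftrightarrow>
     (\<forall>x\<in>\<Omega>. (\<Sum>i\<in>UNIV. \<Sum>j\<in>UNIV.
        partial i (partial j (\<lambda>y. cofactor_matrix (hessian u y) $ i $ j * affine_weight \<theta> u y)) x) = 0)"

end

theory Submission
  imports Defs
begin

text \<open>
  The solution is a sum of two logarithmic barriers in complementary variables. Write
  $N = m + 1$ and split the coordinates as $(s, t, y)$ with $s, t \in \mathbb{R}$ and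
  $y \in \mathbb{R}^{N-2}$; put $\rho = t - |y|^2 / 2$ and
  \[ u = - \log s - b \log \rho \quad\mbox{on}\quad \Omega = \{ s > 0, \ \rho > 0 \}, \qquad b > 0 . \]
  The domain is a half-line times a solid paraboloid, hence convex, and $u$ tends to infinity at
  each boundary point because one of $s$, $\rho$ tends to zero there while both stay bounded above.

  For a sum $u = u_1 + u_2$ in complementary variables the weight is a product $w = w_1 w_2$, and
  the equation $u^{ij} D_{ij} w = 0$ follows from two eigenvalue problems
  $u_k^{ij} D_{ij} w_k = \lambda_k w_k$ with $\lambda_1 + \lambda_2 = 0$.
  For $u_1 = - \log s$ one has $w_1 = s^{2 \theta}$ and $\lambda_1 = 2 \theta (2 \theta - 1)$,
  which is positive for $\theta > 1/2$.
  For $u_2 = - b \log \rho$ the Hessian determinant is $b^m \rho^{-N}$, so that $w_2$ is a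
  multiple of $\rho^{N \theta}$ and $\lambda_2 = N \theta (N \theta - m) / b$, which is negative
  for $\theta < (N - 1) / N$.
  The two eigenvalues cancel for $b = N (N - 1 - N \theta) / (2 (2 \theta - 1))$.

  What is checked below is the divergence form of the equation. The Hessian is
  $P^T D P$ with $D$ diagonal and $P$ a shear (\<open>hessian_u\<close>), which gives positive definiteness,
  the determinant and the inverse at once; Cramer's rule
  (\<open>cofactor_matrix_eq_det_mult_inverse\<close>) turns these into explicit cofactors. All
  $U^{ij} w$ are then built from monomials $s^a \rho^e$ and polynomials in $y$, and adding up their
  second derivatives
  (\<open>sum_partial_weighted_cofactor\<close>) leaves a multiple of $\lambda_1 + \lambda_2$.
\<close>

section \<open>Partial derivatives and the class $C^k$\<close>

abbreviation shift :: "'n::finite \<Rightarrow> real ^ 'n \<Rightarrow> real \<Rightarrow> real ^ 'n" where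
  "shift i x t \<equiv> x + t *\<^sub>R axis i 1"

lemma eventually_shift_mem:
  fixes S :: "(real ^ 'n::finite) set"
  assumes "open S" "x \<in> S"
  shows "eventually (\<lambda>t. shift i x t \<in> S) (nhds 0)"
proof -
  have "((\<lambda>t. shift i x t) \<longlongrightarrow> shift i x 0) (nhds 0)"
    by (intro tendsto_intros filterlim_ident)
  then have "((\<lambda>t. shift i x t) \<longlongrightarrow> x) (nhds 0)" by simp
  then show ?thesis using assms topological_tendstoD by blast
qed

lemma partial_eqI:
  "((\<lambda>t. f (shift i x t)) has_real_derivative D) (at 0) \<Longrightarrow> partial i f x = D"
  unfolding partial_def by (rule DERIV_imp_deriv)

lemma partial_cong:
  assumes "open S" "x \<in> S" "\<And>y. y \<in> S \<Longrightarrow> f y = g y"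
  shows "partial i f x = partial i g x"
  unfolding partial_def using eventually_shift_mem[OF assms(1,2), of i] assms(3)
  by (intro deriv_cong_ev) (auto elim: eventually_mono)

text \<open>Partial derivatives only see a function near the point. Thus a second partial derivative may be
  computed from a closed form \<open>g\<close> that agrees with \<open>f\<close> on an open set only.\<close>

lemma partial_partial_eqI:
  assumes "open S" "x \<in> S" "\<And>y. y \<in> S \<Longrightarrow> f y = g y"
    and "\<And>y. y \<in> S \<Longrightarrow> ((\<lambda>t. g (shift j y t)) has_real_derivative g' y) (at 0)"
    and "((\<lambda>t. g' (shift i x t)) has_real_derivative D) (at 0)"
  shows "partial i (partial j f) x = D"
proof -
  have "partial j f y = g' y" if "y \<in> S" for y
    using partial_cong[OF assms(1) that assms(3)] partial_eqI[OF assms(4)[OF that]] by simp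
  then have "partial i (partial j f) x = partial i g' x"
    by (rule partial_cong[OF assms(1,2)])
  with partial_eqI[of g', OF assms(5)] show ?thesis by simp
qed

lemma has_partials_onD:
  assumes "has_partials_on f S" "x \<in> S"
  shows "((\<lambda>t. f (shift i x t)) has_real_derivative partial i f x) (at 0)"
  using assms unfolding has_partials_on_def partial_def
  by (simp add: DERIV_deriv_iff_real_differentiable)

lemma has_partials_onI:
  "(\<And>i x. x \<in> S \<Longrightarrow> ((\<lambda>t. f (shift i x t)) has_real_derivative D i x) (at 0)) \<Longrightarrow> has_partials_on f S"
  unfolding has_partials_on_def using real_differentiable_def by blast

lemma Ck_on_cong:
  assumes "open S" "\<And>y. y \<in> S \<Longrightarrow> f y = g y"
  shows "Ck_on k f S = Ck_on k g S"
  using assms(2)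
proof (induction k arbitrary: f g)
  case 0
  then show ?case by (simp cong: continuous_on_cong)
next
  case (Suc k)
  have part: "partial i f y = partial i g y" if "y \<in> S" for i y
    using partial_cong[OF assms(1) that Suc.prems] .
  have "has_partials_on f S = has_partials_on g S"
  proof -
    have *: "has_partials_on g S"
      if eq: "\<And>y. y \<in> S \<Longrightarrow> f y = g y" and h: "has_partials_on f S" for f g
      unfolding has_partials_on_def
    proof (intro allI ballI)
      fix i x assume x: "x \<in> S"
      have ev: "eventually (\<lambda>t. f (shift i x t) = g (shift i x t)) (nhds 0)"
        using eventually_shift_mem[OF assms(1) x, of i] eq by (auto elim: eventually_mono)
      have "((\<lambda>t. g (shift i x t)) has_real_derivative partial i f x) (at 0)"
        using has_partials_onD[OF h x, of i] DERIV_cong_ev[OF refl ev refl] by blast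
      then show "(\<lambda>t. g (shift i x t)) differentiable at 0"
        using real_differentiable_def by blast
    qed
    show ?thesis using *[of f g] *[of g f] Suc.prems by metis
  qed
  moreover have "Ck_on k (partial i f) S = Ck_on k (partial i g) S" for i
    by (rule Suc.IH) (rule part)
  moreover have "continuous_on S f = continuous_on S g"
    using Suc.prems by (simp cong: continuous_on_cong)
  ultimately show ?case by simp
qed

text \<open>The introduction rule behind all closure properties of $C^k$ below: it accepts any formula for
  the partial derivatives, which need not be correct outside the open set.\<close>

lemma Ck_on_SucI:
  assumes "open S" "continuous_on S f"
    and "\<And>i x. x \<in> S \<Longrightarrow> ((\<lambda>t. f (shift i x t)) has_real_derivative D i x) (at 0)"
    and "\<And>i. Ck_on k (D i) S"
  shows "Ck_on (Suc k) f S"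
proof -
  have "partial i f x = D i x" if "x \<in> S" for i x
    using assms(3)[OF that] by (rule partial_eqI)
  then have "Ck_on k (partial i f) S" for i
    using Ck_on_cong[OF assms(1), of "partial i f" "D i"] assms(4) by simp
  then show ?thesis using assms(2) has_partials_onI[OF assms(3)] by simp
qed

lemma Ck_on_SucD: "Ck_on (Suc k) f S \<Longrightarrow> Ck_on k f S"
proof (induction k arbitrary: f)
  case (Suc k)
  then show ?case by (meson Ck_on.simps(2))
qed simp

lemma Ck_on_Suc_derivative:
  "Ck_on (Suc k) f S \<Longrightarrow> x \<in> S \<Longrightarrow>
    ((\<lambda>t. f (shift i x t)) has_real_derivative partial i f x) (at 0)"
  by (auto intro: has_partials_onD)

lemma Ck_on_const: "open S \<Longrightarrow> Ck_on k (\<lambda>x. c) S"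
proof (induction k arbitrary: c)
  case (Suc k)
  then show ?case
    by (intro Ck_on_SucI[where D = "\<lambda>i x. 0"]) auto
qed simp

lemma nth_shift [simp]: "shift i x t $ k = x $ k + (if i = k then t else 0)"
  by (simp add: axis_def)

lemma Ck_on_nth: "open S \<Longrightarrow> Ck_on k (\<lambda>x. x $ j) S"
proof (cases k)
  case (Suc m)
  assume "open S"
  then show ?thesis unfolding Suc
    by (intro Ck_on_SucI[where D = "\<lambda>i x. if i = j then 1 else 0"] Ck_on_const continuous_intros)
      (auto intro!: derivative_eq_intros simp del: vector_add_component vector_scaleR_component)
qed (simp add: continuous_on_component)

lemma Ck_on_add:
  assumes "open S" "Ck_on k f S" "Ck_on k g S"
  shows "Ck_on k (\<lambda>x. f x + g x) S"
  using assms(2,3)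
proof (induction k arbitrary: f g)
  case (Suc k)
  show ?case
  proof (rule Ck_on_SucI[OF assms(1)])
    show "Ck_on k (\<lambda>x. partial i f x + partial i g x) S" for i
      using Suc by simp
  qed (use Suc.prems in \<open>auto intro!: continuous_intros DERIV_add Ck_on_Suc_derivative\<close>)
qed (auto intro: continuous_intros)

lemma Ck_on_mult:
  assumes "open S" "Ck_on k f S" "Ck_on k g S"
  shows "Ck_on k (\<lambda>x. f x * g x) S"
  using assms(2,3)
proof (induction k arbitrary: f g)
  case (Suc k)
  show ?case
  proof (rule Ck_on_SucI[OF assms(1)])
    show "Ck_on k (\<lambda>x. partial i f x * g x + partial i g x * f x) S" for i
      by (intro Ck_on_add[OF assms(1)] Suc.IH) (use Suc.prems Ck_on_SucD in auto)
    show "((\<lambda>t. f (shift i x t) * g (shift i x t)) has_real_derivative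
        partial i f x * g x + partial i g x * f x) (at 0)" if "x \<in> S" for i x
      using DERIV_mult[OF Ck_on_Suc_derivative[OF Suc.prems(1) that] Ck_on_Suc_derivative[OF Suc.prems(2) that]]
      by simp
  qed (use Suc.prems in \<open>auto intro!: continuous_intros\<close>)
qed (auto intro: continuous_intros)

lemma Ck_on_sum:
  assumes "open S" "\<And>j. j \<in> J \<Longrightarrow> Ck_on k (f j) S"
  shows "Ck_on k (\<lambda>x. \<Sum>j\<in>J. f j x) S"
  using assms(2)
  by (induction J rule: infinite_finite_induct) (simp_all add: Ck_on_const Ck_on_add assms(1))

lemma Ck_on_inverse:
  assumes "open S" "Ck_on k f S" "\<And>x. x \<in> S \<Longrightarrow> f x \<noteq> 0"
  shows "Ck_on k (\<lambda>x. inverse (f x)) S"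
  using assms(2,3)
proof (induction k arbitrary: f)
  case (Suc k)
  show ?case
  proof (rule Ck_on_SucI[OF assms(1)])
    show "Ck_on k (\<lambda>x. (- 1 * partial i f x) * (inverse (f x) * inverse (f x))) S" for i
      by (intro Ck_on_mult[OF assms(1)] Ck_on_const[OF assms(1)] Suc.IH)
        (use Suc.prems Ck_on_SucD in auto)
    show "((\<lambda>t. inverse (f (shift i x t))) has_real_derivative
        (- 1 * partial i f x) * (inverse (f x) * inverse (f x))) (at 0)" if "x \<in> S" for i x
      using DERIV_inverse_fun[OF Ck_on_Suc_derivative[OF Suc.prems(1) that]] Suc.prems(2)[OF that]
      by (simp add: power2_eq_square divide_inverse mult_ac)
  qed (use Suc.prems in \<open>auto intro!: continuous_intros\<close>)
qed (auto intro: continuous_intros)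

lemma Ck_on_ln:
  assumes "open S" "Ck_on k f S" "\<And>x. x \<in> S \<Longrightarrow> 0 < f x"
  shows "Ck_on k (\<lambda>x. ln (f x)) S"
proof (cases k)
  case 0
  then show ?thesis using assms(2,3) by (force intro: continuous_intros)
next
  case (Suc m)
  have f: "Ck_on (Suc m) f S" using assms(2) Suc by simp
  have pos: "f x \<noteq> 0" if "x \<in> S" for x using assms(3)[OF that] by simp
  show ?thesis unfolding Suc
  proof (rule Ck_on_SucI[OF assms(1)])
    show "continuous_on S (\<lambda>x. ln (f x))"
      using f pos by (auto intro: continuous_intros)
    show "Ck_on m (\<lambda>x. inverse (f x) * partial i f x) S" for i
      by (intro Ck_on_mult[OF assms(1)] Ck_on_inverse[OF assms(1)] Ck_on_SucD[OF f] pos)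
        (use f in auto)
    show "((\<lambda>t. ln (f (shift i x t))) has_real_derivative inverse (f x) * partial i f x) (at 0)"
      if "x \<in> S" for i x
      using DERIV_chain2[OF DERIV_ln Ck_on_Suc_derivative[OF f that, of i]] assms(3)[OF that]
      by simp
  qed
qed

section \<open>Cofactors and shears\<close>

text \<open>Cramer's rule for the column $e_i$ gives the entry $X_{ji}$ as a quotient of determinants whose
  numerator is \<open>A\<close> with column $j$ replaced by $e_i$. In the Leibniz expansion of that
  determinant only permutations sending $i$ to $j$ contribute, and for these the other
  entries of row $i$ never occur; hence they may be cleared as well, as in the cofactor.\<close>

lemma cofactor_matrix_eq_det_mult_inverse:
  fixes A X :: "real ^ 'n::finite ^ 'n"
  assumes "A ** X = mat 1"
  shows "cofactor_matrix A $ i $ j = det A * X $ j $ i"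
proof -
  define B :: "real ^ 'n ^ 'n"
    where "B = (\<chi> k l. if l = j then (A *v column i X) $ k else A $ k $ l)"
  define C :: "real ^ 'n ^ 'n"
    where "C = (\<chi> k l. if k = i \<and> l = j then 1 else if k = i \<or> l = j then 0 else A $ k $ l)"
  have col: "(A *v column i X) $ k = (if k = i then 1 else 0)" for k
  proof -
    have "(A *v column i X) $ k = (A ** X) $ k $ i"
      by (simp add: matrix_vector_mult_def matrix_matrix_mult_def column_def)
    then show ?thesis by (simp add: assms mat_def)
  qed
  have eq: "(\<Prod>k\<in>UNIV. C $ k $ s k) = (\<Prod>k\<in>UNIV. B $ k $ s k)" if "s permutes UNIV" for s
  proof (cases "s i = j")
    case True
    then have "s k \<noteq> j" if "k \<noteq> i" for k
      using permutes_inj[OF \<open>s permutes UNIV\<close>] that by (auto dest: injD)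
    with True show ?thesis
      by (intro prod.cong) (auto simp: B_def C_def col)
  next
    case False
    obtain k where k: "s k = j" using permutes_surj[OF \<open>s permutes UNIV\<close>] by (metis surjD)
    with False have "k \<noteq> i" by auto
    with k have "C $ k $ s k = 0" "B $ k $ s k = 0" by (auto simp: B_def C_def col)
    then have "(\<Prod>k\<in>UNIV. C $ k $ s k) = 0" "(\<Prod>k\<in>UNIV. B $ k $ s k) = 0"
      by (auto intro!: prod_zero)
    then show ?thesis by (simp only:)
  qed
  have "det C = det B"
    unfolding det_def by (intro sum.cong refl) (simp add: eq)
  also have "det B = column i X $ j * det A"
    unfolding B_def by (rule cramer_lemma)
  finally show ?thesis
    by (simp add: cofactor_matrix_def C_def column_def mult.commute)
qed

definition diag :: "('n::finite \<Rightarrow> real) \<Rightarrow> real ^ 'n ^ 'n" where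
  "diag d = (\<chi> i j. if i = j then d i else 0)"

definition shear :: "'n::finite \<Rightarrow> real ^ 'n \<Rightarrow> real ^ 'n ^ 'n" where
  "shear q a = (\<chi> i j. (if i = j then 1 else 0) + (if i = q then a $ j else 0))"

lemma det_diag: "det (diag d) = (\<Prod>i\<in>UNIV. d i)"
  by (subst det_diagonal) (simp_all add: diag_def)

lemma shear_mult:
  assumes "a $ q = 0" "b $ q = 0"
  shows "shear q a ** shear q b = shear q (a + b)"
proof -
  have "(\<Sum>k\<in>UNIV. ((if i = k then 1 else 0) + (if i = q then a $ k else 0)) *
           ((if k = j then 1 else 0) + (if k = q then b $ j else 0)))
        = (if i = j then 1 else 0) + (if i = q then a $ j + b $ j else (0::real))" for i j
  proof -
    have "((if i = k then 1 else 0) + (if i = q then a $ k else 0)) *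
           ((if k = j then 1 else 0) + (if k = q then b $ j else 0))
        = (if k = i then ((if i = j then 1 else 0) + (if i = q then b $ j else 0)) else 0)
          + (if k = j then (if i = q then a $ j else 0) else (0::real))" for k
      using assms by auto
    then show ?thesis by (simp add: sum.distrib)
  qed
  then show ?thesis by (simp add: shear_def matrix_matrix_mult_def vec_eq_iff)
qed

lemma shear_0: "shear q 0 = mat 1"
  by (simp add: shear_def mat_def vec_eq_iff)

text \<open>A shear arises from the identity by adding to row $q$ a combination of the other rows.\<close>

lemma det_shear:
  fixes a :: "real ^ 'n::finite"
  assumes "a $ q = 0"
  shows "det (shear q a) = 1"
proof -
  have row: "row j (mat 1) = (axis j 1 :: real ^ 'n)" for j
    by (simp add: row_def mat_def axis_def vec_eq_iff eq_commute)
  have "(\<Sum>j\<in>UNIV. a $ j *s axis j 1) \<in> vec.span {row j (mat 1) | j. j \<noteq> q}"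
  proof (intro vec.span_sum)
    fix j
    have "row j (mat 1 :: real ^ 'n ^ 'n) \<in> {row j (mat 1) | j. j \<noteq> q}" if "j \<noteq> q"
      using that by blast
    then show "a $ j *s axis j 1 \<in> vec.span {row j (mat 1) | j. j \<noteq> q}"
      using assms by (cases "j = q") (auto simp: vec.span_zero row intro: vec.span_scale vec.span_base)
  qed
  then have "a \<in> vec.span {row j (mat 1) | j. j \<noteq> q}"
    by (simp add: basis_expansion)
  from det_row_span[OF this]
  have "det (\<chi> k. if k = q then row q (mat 1) + a else row k (mat 1)) = 1" by simp
  moreover have "(\<chi> k. if k = q then row q (mat 1) + a else row k (mat 1)) = shear q a"
    by (auto simp: shear_def vec_eq_iff row axis_def)
  ultimately show ?thesis by simp
qed

section \<open>A sum of two logarithmic barriers\<close>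

text \<open>The index type has no order, so the roles of the coordinates are fixed by two distinguished
  indices: $s = x_p$ and $t = x_q$, while the remaining indices carry $y$.\<close>

locale log_potential =
  fixes p q :: "'n::finite" and b :: real
  assumes p_neq_q: "p \<noteq> q" and b_pos: "0 < b"
begin

definition R :: "'n set" where "R = - {p, q}"

definition \<rho> :: "real ^ 'n \<Rightarrow> real" where
  "\<rho> x = x $ q - (\<Sum>r\<in>R. (x $ r)\<^sup>2) / 2"

definition \<Omega> :: "(real ^ 'n) set" where
  "\<Omega> = {x. 0 < x $ p \<and> 0 < \<rho> x}"

definition u :: "real ^ 'n \<Rightarrow> real" where
  "u x = - ln (x $ p) - b * ln (\<rho> x)"

text \<open>The gradient of $|y|^2/2$; the definition after it is the gradient of $\rho$.\<close>

definition h :: "real ^ 'n \<Rightarrow> real ^ 'n" where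
  "h x = (\<chi> r. if r \<in> R then x $ r else 0)"

definition \<rho>' :: "'n \<Rightarrow> real ^ 'n \<Rightarrow> real" where
  "\<rho>' i x = (if i = q then 1 else 0) - h x $ i"

lemma pq_notin_R [simp]: "p \<notin> R" "q \<notin> R" "q \<noteq> p"
  using p_neq_q by (auto simp: R_def)

lemma h_pq [simp]: "h x $ p = 0" "h x $ q = 0"
  by (simp_all add: h_def)

lemma R_neq:
  assumes "r \<in> R"
  shows "r \<noteq> p" "r \<noteq> q" "p \<noteq> r" "q \<noteq> r"
  using assms by (auto simp: R_def)

lemma index_cases: obtains "i = p" | "i = q" | "i \<in> R" "i \<noteq> p" "i \<noteq> q"
  by (auto simp: R_def)

lemma UNIV_split: "sum f UNIV = f p + f q + sum f R"
proof -
  have U: "UNIV = insert p (insert q R)" by (auto simp: R_def)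
  show ?thesis unfolding U using p_neq_q by (simp add: add.assoc)
qed

lemma prod_UNIV_split: "prod f UNIV = f p * f q * prod f R"
proof -
  have U: "UNIV = insert p (insert q R)" by (auto simp: R_def)
  show ?thesis unfolding U using p_neq_q by (simp add: mult.assoc)
qed

lemma card_R: "card R = CARD('n) - 2"
  using p_neq_q by (simp add: R_def Compl_eq_Diff_UNIV card_Diff_subset)

lemma continuous_on_\<rho>: "continuous_on S \<rho>"
  unfolding \<rho>_def by (auto intro!: continuous_intros continuous_on_component)

lemma \<Omega>D: "x \<in> \<Omega> \<Longrightarrow> 0 < x $ p" "x \<in> \<Omega> \<Longrightarrow> 0 < \<rho> x"
  by (simp_all add: \<Omega>_def)

lemma open_\<Omega>: "open \<Omega>"
  unfolding \<Omega>_def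
  by (intro open_Collect_conj open_Collect_less continuous_intros continuous_on_component continuous_on_\<rho>)

text \<open>The function $\rho$ is concave, since for $s + t = 1$ the convexity defect of a square is
  $s t (x_r - y_r)^2$.\<close>

lemma convex_\<Omega>: "convex \<Omega>"
proof (rule convexI)
  fix x y :: "real ^ 'n" and s t :: real
  assume x: "x \<in> \<Omega>" and y: "y \<in> \<Omega>" and s: "0 \<le> s" and t: "0 \<le> t" and st: "s + t = 1"
  have pos: "0 < s * c + t * d" if "0 < c" "0 < d" for c d :: real
    using that s t st by (metis add.left_neutral add_nonneg_pos add_pos_nonneg less_eq_real_def mult_1 mult_nonneg_nonneg mult_pos_pos)
  have "(\<Sum>r\<in>R. (s * x $ r + t * y $ r)\<^sup>2) \<le> (\<Sum>r\<in>R. s * (x $ r)\<^sup>2 + t * (y $ r)\<^sup>2)"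
  proof (rule sum_mono)
    fix r
    have "s * (x $ r)\<^sup>2 + t * (y $ r)\<^sup>2 - (s * x $ r + t * y $ r)\<^sup>2 = s * t * (x $ r - y $ r)\<^sup>2"
      unfolding eq_diff_eq[THEN iffD2, OF st] by (simp add: power2_eq_square algebra_simps)
    moreover have "0 \<le> s * t * (x $ r - y $ r)\<^sup>2" using s t by simp
    ultimately show "(s * x $ r + t * y $ r)\<^sup>2 \<le> s * (x $ r)\<^sup>2 + t * (y $ r)\<^sup>2" by linarith
  qed
  then have "s * \<rho> x + t * \<rho> y \<le> \<rho> (s *\<^sub>R x + t *\<^sub>R y)"
    by (simp add: \<rho>_def sum.distrib sum_distrib_left[symmetric] algebra_simps)
  then show "s *\<^sub>R x + t *\<^sub>R y \<in> \<Omega>"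
    using pos[OF \<Omega>D(1)[OF x] \<Omega>D(1)[OF y]] pos[OF \<Omega>D(2)[OF x] \<Omega>D(2)[OF y]]
    by (simp add: \<Omega>_def)
qed

text \<open>On this half-line $\rho = 1$, so that $u$ is the bare logarithm of one variable.\<close>

lemma coordinate_plane_mem_\<Omega>:
  assumes "0 < s"
  shows "s *\<^sub>R axis p 1 + axis q 1 \<in> \<Omega>" "u (s *\<^sub>R axis p 1 + axis q 1) = - ln s"
proof -
  let ?x = "s *\<^sub>R axis p 1 + axis q 1 :: real ^ 'n"
  have "?x $ r = 0" if "r \<in> R" for r using that by (auto simp: R_def axis_def)
  then have "\<rho> ?x = 1" using p_neq_q by (simp add: \<rho>_def axis_def)
  moreover have "?x $ p = s" using p_neq_q by (simp add: axis_def)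
  ultimately show "?x \<in> \<Omega>" "u ?x = - ln s" using assms by (simp_all only: \<Omega>_def u_def) simp_all
qed

lemma not_quadratic_u: "\<not> quadratic_on \<Omega> u"
proof
  assume "quadratic_on \<Omega> u"
  then obtain A c d where q: "\<And>x. x \<in> \<Omega> \<Longrightarrow> u x = x \<bullet> (A *v x) + c \<bullet> x + d"
    unfolding quadratic_on_def by blast
  define P Q :: "real ^ 'n" where "P = axis p 1" and "Q = axis q 1"
  have eq: "- ln s = s\<^sup>2 * (P \<bullet> (A *v P)) + s * (P \<bullet> (A *v Q) + Q \<bullet> (A *v P) + c \<bullet> P)
      + (Q \<bullet> (A *v Q) + c \<bullet> Q + d)" if "0 < s" for s
    using q[OF coordinate_plane_mem_\<Omega>(1)[OF that]] coordinate_plane_mem_\<Omega>(2)[OF that]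
    by (simp add: P_def[symmetric] Q_def[symmetric] matrix_vector_right_distrib
        matrix_vector_mult_scaleR inner_add_left inner_add_right power2_eq_square algebra_simps)
  define L where "L = ln (2::real)"
  have ln_pow: "ln 2 = L" "ln 4 = 2 * L" "ln 8 = 3 * L" "0 < L"
    using ln_realpow[of 2 2] ln_realpow[of 2 3] by (simp_all add: L_def)
  \<comment> \<open>The values at $2^k$, $k = 0, \dots, 3$, are linear in $k$ on the left but combinations of
    $4^k$, $2^k$ and $1$ on the right; the recurrence with roots $4, 2, 1$ kills only the latter.\<close>
  show False
    using eq[of 1] eq[of 2] eq[of 4] eq[of 8] ln_pow(4) unfolding ln_pow(1-3) by simp
qed

lemma filterlim_minus_ln:
  fixes f :: "'b \<Rightarrow> real"
  assumes "(f \<longlongrightarrow> l) F" "l = 0" "\<forall>\<^sub>F x in F. 0 < f x"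
  shows "filterlim (\<lambda>x. - ln (f x)) at_top F"
proof -
  have "filterlim f (at_right 0) F"
    using assms by (simp add: filterlim_at)
       (auto elim: eventually_mono)
  then show ?thesis
    unfolding filterlim_uminus_at_top
    using filterlim_compose[OF ln_at_0] by simp
qed

text \<open>At a frontier point at least one of $x_p$, $\rho$ vanishes. Its logarithmic term diverges, and
  the other term either diverges too or has a finite limit.\<close>

lemma u_at_frontier:
  assumes "z \<in> frontier \<Omega>"
  shows "filterlim u at_top (at z within \<Omega>)"
proof -
  let ?F = "at z within \<Omega>"
  have "closed {x. 0 \<le> x $ p \<and> 0 \<le> \<rho> x}"
    by (intro closed_Collect_conj closed_Collect_le continuous_intros continuous_on_component continuous_on_\<rho>)
  moreover have "\<Omega> \<subseteq> {x. 0 \<le> x $ p \<and> 0 \<le> \<rho> x}" by (auto simp: \<Omega>_def)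
  ultimately have "closure \<Omega> \<subseteq> {x. 0 \<le> x $ p \<and> 0 \<le> \<rho> x}" by (rule closure_minimal[rotated])
  moreover have z: "z \<in> closure \<Omega>" "z \<notin> \<Omega>"
    using assms open_\<Omega> by (auto simp: frontier_def interior_open)
  ultimately have ge: "0 \<le> z $ p" "0 \<le> \<rho> z" and zero: "z $ p = 0 \<or> \<rho> z = 0"
    by (auto simp: \<Omega>_def)
  have lim_p: "((\<lambda>x. x $ p) \<longlongrightarrow> z $ p) ?F" by (intro tendsto_intros)
  have lim_\<rho>: "(\<rho> \<longlongrightarrow> \<rho> z) ?F"
    using continuous_on_\<rho>[of UNIV] by (meson UNIV_I continuous_on_def tendsto_within_subset subset_UNIV)
  have mem: "\<forall>\<^sub>F x in ?F. x \<in> \<Omega>" by (simp add: eventually_at_filter)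
  have pos: "\<forall>\<^sub>F x in ?F. 0 < x $ p" "\<forall>\<^sub>F x in ?F. 0 < \<rho> x"
    using mem by (auto elim!: eventually_mono dest: \<Omega>D)
  have u: "u = (\<lambda>x. - ln (x $ p) + b * (- ln (\<rho> x)))" by (simp add: u_def fun_eq_iff)
  have mult: "filterlim (\<lambda>x. b * (- ln (\<rho> x))) at_top ?F" if "\<rho> z = 0"
    by (rule filterlim_tendsto_pos_mult_at_top[OF tendsto_const b_pos filterlim_minus_ln[OF lim_\<rho> that pos(2)]])
  consider "z $ p = 0" "\<rho> z = 0" | "z $ p = 0" "\<rho> z \<noteq> 0" | "z $ p \<noteq> 0" "\<rho> z = 0"
    using zero by blast
  then show ?thesis
  proof cases
    case 1
    then show ?thesis unfolding u
      by (intro filterlim_at_top_add_at_top filterlim_minus_ln[OF lim_p _ pos(1)] mult)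
  next
    case 2
    have "((\<lambda>x. b * (- ln (\<rho> x))) \<longlongrightarrow> b * (- ln (\<rho> z))) ?F"
      using 2 by (intro tendsto_intros lim_\<rho>)
    from filterlim_tendsto_add_at_top[OF this filterlim_minus_ln[OF lim_p 2(1) pos(1)]]
    show ?thesis unfolding u by (simp add: add.commute)
  next
    case 3
    have "((\<lambda>x. - ln (x $ p)) \<longlongrightarrow> - ln (z $ p)) ?F"
      using 3 by (intro tendsto_intros lim_p)
    from filterlim_tendsto_add_at_top[OF this mult[OF 3(2)]]
    show ?thesis unfolding u .
  qed
qed

lemma Ck_on_u: "Ck_on k u \<Omega>"
proof -
  have \<rho>: "Ck_on k \<rho> \<Omega>"
  proof -
    have "Ck_on k (\<lambda>x. x $ q + (\<Sum>r\<in>R. x $ r * x $ r) * (- 1 / 2)) \<Omega>"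
      by (intro Ck_on_add Ck_on_mult Ck_on_sum Ck_on_const Ck_on_nth open_\<Omega>)
    then show ?thesis by (simp add: \<rho>_def[abs_def] power2_eq_square)
  qed
  have "Ck_on k (\<lambda>x. (- 1) * ln (x $ p) + (- b) * ln (\<rho> x)) \<Omega>"
    by (intro Ck_on_add Ck_on_mult Ck_on_const Ck_on_ln Ck_on_nth \<rho> open_\<Omega> \<Omega>D)
  then show ?thesis by (simp add: u_def[abs_def])
qed

section \<open>The Hessian of the potential\<close>

lemma nth_shift_derivative [derivative_intros]:
  "((\<lambda>t. shift i x t $ k) has_real_derivative (if i = k then 1 else 0)) (at 0)"
  by (simp del: vector_add_component vector_scaleR_component) (auto intro!: derivative_eq_intros)

lemma \<rho>_shift_derivative:
  "((\<lambda>t. \<rho> (shift i x t)) has_real_derivative \<rho>' i x) (at 0)"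
proof -
  have "((\<lambda>t. \<Sum>r\<in>R. (shift i x t $ r)\<^sup>2) has_real_derivative
      (\<Sum>r\<in>R. if r = i then 2 * x $ r else 0)) (at 0)"
  proof (rule DERIV_sum)
    fix r
    have "(if r = i then 2 * x $ r else 0) = of_nat 2 * ((if i = r then 1 else 0) * shift i x 0 $ r ^ (2 - Suc 0))"
      by simp
    then show "((\<lambda>t. (shift i x t $ r)\<^sup>2) has_real_derivative (if r = i then 2 * x $ r else 0)) (at 0)"
      using DERIV_power[OF nth_shift_derivative[of x i r], of 2] by (simp only:)
  qed
  then have "((\<lambda>t. \<rho> (shift i x t)) has_real_derivative
      (if i = q then 1 else 0) - (\<Sum>r\<in>R. if r = i then 2 * x $ r else 0) / 2) (at 0)"
    unfolding \<rho>_def by (intro DERIV_diff DERIV_cdivide nth_shift_derivative)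
  then show ?thesis by (cases i rule: index_cases) (simp_all add: \<rho>'_def h_def)
qed

lemma h_shift_derivative:
  "((\<lambda>t. h (shift i x t) $ k) has_real_derivative (if i = k \<and> i \<in> R then 1 else 0)) (at 0)"
  unfolding h_def by (cases "k \<in> R")
    (auto simp del: vector_add_component vector_scaleR_component intro!: derivative_eq_intros)

lemma \<rho>'_shift_derivative:
  "((\<lambda>t. \<rho>' k (shift i x t)) has_real_derivative - (if i = k \<and> i \<in> R then 1 else 0)) (at 0)"
  unfolding \<rho>'_def by (rule derivative_eq_intros h_shift_derivative refl | simp)+

text \<open>The diagonal factor $D$ in the factorization $P^T D P$ of the Hessian.\<close>

definition pivot :: "real ^ 'n \<Rightarrow> 'n \<Rightarrow> real" where
  "pivot x i = (if i = p then 1 / (x $ p)\<^sup>2 else if i = q then b / (\<rho> x)\<^sup>2 else b / \<rho> x)"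

lemma hessian_u_entry:
  assumes "x \<in> \<Omega>"
  shows "partial i (partial j u) x = (if i = p \<and> j = p then 1 / (x $ p)\<^sup>2 else 0)
    + b / (\<rho> x)\<^sup>2 * \<rho>' i x * \<rho>' j x + (if i = j \<and> i \<in> R then b / \<rho> x else 0)"
proof (rule partial_partial_eqI[where f = u and g = u, OF open_\<Omega> assms refl])
  show "((\<lambda>t. u (shift j y t)) has_real_derivative
      - (if j = p then 1 else 0) / y $ p - b * (\<rho>' j y / \<rho> y)) (at 0)" if "y \<in> \<Omega>" for y
    unfolding u_def using \<Omega>D[OF that]
    by (auto intro!: derivative_eq_intros \<rho>_shift_derivative simp del: vector_add_component vector_scaleR_component)
  show "((\<lambda>t. - (if j = p then 1 else 0) / shift i x t $ p - b * (\<rho>' j (shift i x t) / \<rho> (shift i x t)))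
      has_real_derivative (if i = p \<and> j = p then 1 / (x $ p)\<^sup>2 else 0)
    + b / (\<rho> x)\<^sup>2 * \<rho>' i x * \<rho>' j x + (if i = j \<and> i \<in> R then b / \<rho> x else 0)) (at 0)"
    using \<Omega>D[OF assms]
    by (auto intro!: derivative_eq_intros \<rho>_shift_derivative \<rho>'_shift_derivative
       simp: field_simps power2_eq_square simp del: vector_add_component vector_scaleR_component)
qed

text \<open>The Hessian of $- b \log \rho$ is $- (b / \rho) D^2 \rho$, which is diagonal, plus the rank-one
  matrix $(b / \rho^2) \nabla \rho \otimes \nabla \rho$. Since $\partial_q \rho = 1$, replacing row $q$
  of the identity by $\nabla \rho$ is a shear, and it turns the rank-one term into the $q$-th diagonal
  entry.\<close>

lemma hessian_u:
  assumes "x \<in> \<Omega>"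
  shows "hessian u x = transpose (shear q (- h x)) ** diag (pivot x) ** shear q (- h x)"
proof -
  have "(\<Sum>k\<in>UNIV. (\<Sum>l\<in>UNIV. shear q (- h x) $ l $ i * diag (pivot x) $ l $ k) * shear q (- h x) $ k $ j)
     = partial i (partial j u) x" for i j
  proof -
    have *: "(\<Sum>l\<in>UNIV. shear q (- h x) $ l $ i * diag (pivot x) $ l $ k) = shear q (- h x) $ k $ i * pivot x k" for k
      by (simp add: diag_def if_distrib cong: if_cong)
    have **: "(\<Sum>k\<in>R. shear q (- h x) $ k $ i * pivot x k * shear q (- h x) $ k $ j)
      = (\<Sum>k\<in>R. if k = i then if i = j then b / \<rho> x else 0 else 0)"
      by (rule sum.cong) (auto simp: shear_def pivot_def R_def)
    show ?thesis
      unfolding * UNIV_split ** hessian_u_entry[OF assms]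
      using p_neq_q by (cases i rule: index_cases; cases j rule: index_cases)
        (auto simp: shear_def pivot_def \<rho>'_def)
  qed
  then show ?thesis
    by (simp add: hessian_def vec_eq_iff matrix_matrix_mult_def transpose_def)
qed

lemma pivot_pos: "x \<in> \<Omega> \<Longrightarrow> 0 < pivot x i"
  using \<Omega>D[of x] b_pos by (simp add: pivot_def)

text \<open>The quadratic form of $P^T D P$ at $v$ is that of $D$ at $P v$, and $P$ is injective.\<close>

lemma positive_definite_hessian_u:
  assumes "x \<in> \<Omega>"
  shows "positive_definite (hessian u x)"
  unfolding positive_definite_def
proof (intro conjI allI impI)
  let ?P = "shear q (- h x)"
  have diag: "transpose (diag d) = (diag d :: real ^ 'n ^ 'n)" for d :: "'n \<Rightarrow> real"
    by (simp add: diag_def transpose_def vec_eq_iff)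
  show "transpose (hessian u x) = hessian u x"
    by (simp add: hessian_u[OF assms] matrix_transpose_mul diag matrix_mul_assoc)
  fix v :: "real ^ 'n" assume "v \<noteq> 0"
  have "shear q (h x) ** ?P = mat 1" by (simp add: shear_mult shear_0)
  then have "shear q (h x) *v (?P *v v) = v" by (simp add: matrix_vector_mul_assoc)
  with \<open>v \<noteq> 0\<close> have "?P *v v \<noteq> 0" by auto
  then obtain k where k: "(?P *v v) $ k \<noteq> 0" by (auto simp: vec_eq_iff)
  have "v \<bullet> (transpose ?P *v y) = (?P *v v) \<bullet> y" for y
    by (metis dot_lmul_matrix inner_commute transpose_matrix_vector)
  then have "v \<bullet> (hessian u x *v v) = (?P *v v) \<bullet> (diag (pivot x) *v (?P *v v))"
    by (simp only: hessian_u[OF assms] flip: matrix_vector_mul_assoc)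
  also have "\<dots> = (\<Sum>i\<in>UNIV. pivot x i * ((?P *v v) $ i)\<^sup>2)"
  proof -
    have "diag d *v y = (\<chi> i. d i * y $ i)" for d :: "'n \<Rightarrow> real" and y
      by (simp add: diag_def matrix_vector_mult_def if_distrib[of "\<lambda>c. c * _"] cong: if_cong)
    then show ?thesis by (simp add: inner_vec_def power2_eq_square mult_ac)
  qed
  also have "\<dots> > 0"
    using k pivot_pos[OF assms]
    by (intro sum_pos2[of _ k]) (simp_all add: less_imp_le)
  finally show "0 < v \<bullet> (hessian u x *v v)" .
qed

section \<open>Cofactors of the Hessian\<close>

definition sq :: "real ^ 'n \<Rightarrow> real" where
  "sq x = (\<Sum>r\<in>R. (x $ r)\<^sup>2)"

text \<open>The bracket is the entry of $(D^2 u)^{-1} = Q D^{-1} Q^T$, where $Q = P^{-1}$ is the opposite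
  shear. It simplifies because \<open>h\<close> is supported on \<open>R\<close>, where all entries of $D^{-1}$ equal
  $\rho / b$.\<close>

lemma cofactor_hessian_u:
  assumes "x \<in> \<Omega>"
  shows "cofactor_matrix (hessian u x) $ i $ j = det (hessian u x) *
    ((if i = j then 1 / pivot x i else 0) + \<rho> x / b * ((if i = q then h x $ j else 0)
      + (if j = q then h x $ i else 0) + (if i = q \<and> j = q then sq x else 0)))"
proof -
  let ?P = "shear q (- h x)" and ?Q = "shear q (h x)"
  let ?D = "diag (pivot x)" and ?D' = "diag (\<lambda>i. 1 / pivot x i)"
  let ?X = "?Q ** ?D' ** transpose ?Q"
  have PQ: "?P ** ?Q = mat 1" "?Q ** ?P = mat 1"
    by (simp_all add: shear_mult shear_0)
  have DD: "?D ** ?D' = mat 1"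
    using pivot_pos[OF assms]
    by (simp add: diag_def matrix_matrix_mult_def mat_def vec_eq_iff if_distrib[of "\<lambda>c. c * _"] less_imp_neq[symmetric] cong: if_cong)
  have "hessian u x ** ?X = transpose ?P ** (?D ** (?P ** ?Q) ** ?D') ** transpose ?Q"
    by (simp only: hessian_u[OF assms] matrix_mul_assoc)
  also have "\<dots> = transpose (?Q ** ?P)"
    by (simp only: PQ(1) matrix_mul_rid DD matrix_transpose_mul)
  finally have inv: "hessian u x ** ?X = mat 1" by (simp add: PQ)
  have D: "?Q ** ?D' = (\<chi> i k. ?Q $ i $ k / pivot x k)"
    by (simp add: diag_def matrix_matrix_mult_def vec_eq_iff if_distrib[of "\<lambda>c. _ * c"] cong: if_cong)
  have "?X $ j $ i = (\<Sum>k\<in>UNIV. ?Q $ j $ k / pivot x k * ?Q $ i $ k)"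
    unfolding D by (simp add: matrix_matrix_mult_def transpose_def)
  also have "\<dots> = (\<Sum>k\<in>UNIV. (if k = i then if i = j then 1 / pivot x i else 0 else 0)
      + (if k = i then if j = q then h x $ i / pivot x i else 0 else 0)
      + (if k = j then if i = q then h x $ j / pivot x j else 0 else 0)
      + (if i = q \<and> j = q then (h x $ k)\<^sup>2 / pivot x k else 0))"
    by (intro sum.cong refl) (auto simp: shear_def add_divide_distrib power2_eq_square algebra_simps)
  also have "\<dots> = (if i = j then 1 / pivot x i else 0) + (if j = q then h x $ i / pivot x i else 0)
      + (if i = q then h x $ j / pivot x j else 0)
      + (if i = q \<and> j = q then \<Sum>k\<in>UNIV. (h x $ k)\<^sup>2 / pivot x k else 0)"
    by (cases "i = q \<and> j = q") (auto simp: sum.distrib)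
  also have "(\<Sum>k\<in>UNIV. (h x $ k)\<^sup>2 / pivot x k) = \<rho> x / b * sq x"
    by (simp add: UNIV_split sq_def sum_distrib_left)
      (intro sum.cong refl, auto simp: h_def pivot_def R_def)
  also have hc: "h x $ k / pivot x k = \<rho> x / b * h x $ k" for k
    by (cases k rule: index_cases) (simp_all add: pivot_def)
  finally have "?X $ j $ i = (if i = j then 1 / pivot x i else 0) + \<rho> x / b * ((if i = q then h x $ j else 0)
      + (if j = q then h x $ i else 0) + (if i = q \<and> j = q then sq x else 0))"
    by (simp add: hc algebra_simps)
  then show ?thesis
    by (simp only: cofactor_matrix_eq_det_mult_inverse[OF inv])
qed

definition monomial :: "real \<Rightarrow> real \<Rightarrow> real ^ 'n \<Rightarrow> real" where
  "monomial a e x = x $ p powr a * \<rho> x powr e"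

lemma det_hessian_u_powr:
  assumes "x \<in> \<Omega>"
  shows "det (hessian u x) powr c
    = b powr ((real CARD('n) - 1) * c) * monomial (- 2 * c) (- real CARD('n) * c) x"
proof -
  note pos = \<Omega>D[OF assms] b_pos
  have "2 \<le> CARD('n)"
    using card_mono[of "UNIV :: 'n set" "{p, q}"] p_neq_q by simp
  then have N: "real (card R) = real CARD('n) - 2" by (simp add: card_R)
  have "det (hessian u x) = (\<Prod>i\<in>UNIV. pivot x i)"
    by (simp add: hessian_u[OF assms] det_mul det_transpose det_shear det_diag)
  also have "\<dots> = 1 / (x $ p)\<^sup>2 * (b / (\<rho> x)\<^sup>2) * (\<Prod>i\<in>R. b / \<rho> x)"
    unfolding prod_UNIV_split by (intro arg_cong2[of _ _ _ _ "(*)"] prod.cong) (auto simp: pivot_def R_def)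
  also have "\<dots> = x $ p powr (- 2) * (b * \<rho> x powr (- 2)) * (b / \<rho> x) powr real (card R)"
    using pos by (simp add: powr_minus powr_realpow divide_inverse)
  also have "\<dots> = x $ p powr (- 2) * (b powr 1 * b powr (real CARD('n) - 2))
      * (\<rho> x powr (- 2) * \<rho> x powr (- (real CARD('n) - 2)))"
    using pos unfolding N by (simp add: powr_divide powr_minus_divide del: minus_diff_eq)
  also have "\<dots> = x $ p powr (- 2) * b powr (real CARD('n) - 1) * \<rho> x powr (- real CARD('n))"
  proof -
    have "b powr 1 * b powr (real CARD('n) - 2) = b powr (real CARD('n) - 1)"
      "\<rho> x powr (- 2) * \<rho> x powr (- (real CARD('n) - 2)) = \<rho> x powr (- real CARD('n))"
      by (subst powr_add[symmetric], simp)+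
    then show ?thesis by (simp only:)
  qed
  finally show ?thesis
    using pos by (simp add: powr_mult powr_powr monomial_def)
qed

lemma det_hessian_u_pos: "x \<in> \<Omega> \<Longrightarrow> 0 < det (hessian u x)"
  by (simp add: hessian_u det_mul det_transpose det_shear det_diag prod_pos pivot_pos)

lemma monomial_mult:
  assumes "x \<in> \<Omega>"
  shows "(x $ p)\<^sup>2 * monomial a e x = monomial (a + 2) e x" "\<rho> x * monomial a e x = monomial a (e + 1) x"
  using \<Omega>D[OF assms] by (simp_all add: monomial_def powr_add powr_realpow)

lemma monomial_shift_derivative:
  assumes "x \<in> \<Omega>"
  shows "((\<lambda>t. monomial a e (shift i x t)) has_real_derivative
    (if i = p then a * monomial (a - 1) e x else 0) + e * \<rho>' i x * monomial a (e - 1) x) (at 0)"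
proof -
  note pos = \<Omega>D[OF assms]
  have d1: "((\<lambda>t. (shift i x t $ p) powr a) has_real_derivative (if i = p then a * (x $ p) powr (a - 1) else 0)) (at 0)"
    using DERIV_fun_powr[OF nth_shift_derivative[of x i p], of a] pos by auto
  have d2: "((\<lambda>t. \<rho> (shift i x t) powr e) has_real_derivative e * \<rho> x powr (e - 1) * \<rho>' i x) (at 0)"
    using DERIV_fun_powr[OF \<rho>_shift_derivative[of x i], of e] pos by simp
  show ?thesis
    unfolding monomial_def by (rule DERIV_cong[OF DERIV_mult[OF d1 d2]]) (auto simp: algebra_simps)
qed

section \<open>The equation\<close>

lemma sq_shift_derivative:
  "((\<lambda>t. sq (shift q x t)) has_real_derivative 0) (at 0)"
proof -
  have "sq (shift q x t) = sq x" for t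
    unfolding sq_def nth_shift by (intro sum.cong) (auto simp: R_def)
  then show ?thesis by simp
qed

lemma \<rho>'_simps: "\<rho>' q x = 1" "r \<in> R \<Longrightarrow> \<rho>' r x = - (x $ r)" "\<rho>' p x = 0"
  by (auto simp: \<rho>'_def h_def R_def p_neq_q)

definition weighted_cofactor :: "real \<Rightarrow> 'n \<Rightarrow> 'n \<Rightarrow> real ^ 'n \<Rightarrow> real" where
  "weighted_cofactor \<theta> i j x = cofactor_matrix (hessian u x) $ i $ j * affine_weight \<theta> u x"

text \<open>The cofactor is $\det D^2 u$ times an inverse entry, so that $U^{ij} w$ carries the factor
  $(\det D^2 u)^{1 - \theta} = K x_p^{- \alpha} \rho^{- \beta}$ with the following constants.\<close>

context
  fixes \<theta> \<alpha> \<beta> K :: real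
  assumes \<alpha>: "\<alpha> = 2 * (1 - \<theta>)" and \<beta>: "\<beta> = real CARD('n) * (1 - \<theta>)"
    and K: "K = b powr ((real CARD('n) - 1) * (1 - \<theta>))"
begin

lemma weighted_cofactor_eq:
  assumes "x \<in> \<Omega>"
  shows "weighted_cofactor \<theta> i j x = K * monomial (- \<alpha>) (- \<beta>) x *
    ((if i = j then 1 / pivot x i else 0) + \<rho> x / b * ((if i = q then h x $ j else 0)
      + (if j = q then h x $ i else 0) + (if i = q \<and> j = q then sq x else 0)))"
proof -
  have "det (hessian u x) * det (hessian u x) powr (- \<theta>) = det (hessian u x) powr (1 - \<theta>)"
    using det_hessian_u_pos[OF assms] by (simp add: powr_diff powr_minus divide_inverse)
  also have "\<dots> = K * monomial (- \<alpha>) (- \<beta>) x"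
    unfolding det_hessian_u_powr[OF assms] by (simp add: \<alpha> \<beta> K)
  finally have "K * monomial (- \<alpha>) (- \<beta>) x = det (hessian u x) * det (hessian u x) powr (- \<theta>)" ..
  then show ?thesis
    unfolding weighted_cofactor_def affine_weight_def cofactor_hessian_u[OF assms]
    by (simp only: mult.assoc mult.commute mult.left_commute)
qed

lemma weighted_cofactor_entries:
  assumes x: "x \<in> \<Omega>"
  shows "weighted_cofactor \<theta> p p x = K * monomial (2 - \<alpha>) (- \<beta>) x"
    and "weighted_cofactor \<theta> q q x = K / b * (monomial (- \<alpha>) (2 - \<beta>) x + sq x * monomial (- \<alpha>) (1 - \<beta>) x)"
    and "r \<in> R \<Longrightarrow> weighted_cofactor \<theta> r r x = K / b * monomial (- \<alpha>) (1 - \<beta>) x"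
    and "r \<in> R \<Longrightarrow> weighted_cofactor \<theta> r q x = K / b * (x $ r * monomial (- \<alpha>) (1 - \<beta>) x)"
    and "r \<in> R \<Longrightarrow> weighted_cofactor \<theta> q r x = K / b * (x $ r * monomial (- \<alpha>) (1 - \<beta>) x)"
proof -
  have m: "monomial (2 - \<alpha>) (- \<beta>) x = (x $ p)\<^sup>2 * monomial (- \<alpha>) (- \<beta>) x"
    "monomial (- \<alpha>) (1 - \<beta>) x = \<rho> x * monomial (- \<alpha>) (- \<beta>) x"
    "monomial (- \<alpha>) (2 - \<beta>) x = \<rho> x * (\<rho> x * monomial (- \<alpha>) (- \<beta>) x)"
    unfolding monomial_mult[OF x] by simp_all
  note simps = weighted_cofactor_eq[OF x] m pivot_def h_def power2_eq_square
  show "weighted_cofactor \<theta> p p x = K * monomial (2 - \<alpha>) (- \<beta>) x"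
    using p_neq_q by (simp add: simps)
  show "weighted_cofactor \<theta> q q x = K / b * (monomial (- \<alpha>) (2 - \<beta>) x + sq x * monomial (- \<alpha>) (1 - \<beta>) x)"
    by (simp add: simps algebra_simps)
  show "weighted_cofactor \<theta> r r x = K / b * monomial (- \<alpha>) (1 - \<beta>) x" if "r \<in> R"
    using that R_neq[OF that] by (simp add: simps)
  show "weighted_cofactor \<theta> r q x = K / b * (x $ r * monomial (- \<alpha>) (1 - \<beta>) x)" if "r \<in> R"
    using that R_neq[OF that] by (simp add: simps)
  show "weighted_cofactor \<theta> q r x = K / b * (x $ r * monomial (- \<alpha>) (1 - \<beta>) x)" if "r \<in> R"
    using that R_neq[OF that] by (simp add: simps)
qed

lemma weighted_cofactor_zero:
  assumes "i \<noteq> j" "i = p \<or> j = p \<or> i \<in> R \<and> j \<in> R" "x \<in> \<Omega>"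
  shows "weighted_cofactor \<theta> i j x = 0"
  using assms p_neq_q by (auto simp: weighted_cofactor_eq)

lemma partial_weighted_cofactor_zero:
  assumes "i \<noteq> j" "i = p \<or> j = p \<or> i \<in> R \<and> j \<in> R" "x \<in> \<Omega>"
  shows "partial i (partial j (weighted_cofactor \<theta> i j)) x = 0"
  using weighted_cofactor_zero[OF assms(1,2)]
  by (intro partial_partial_eqI[where g = "\<lambda>_. 0" and g' = "\<lambda>_. 0", OF open_\<Omega> assms(3)]) auto

lemma partial_weighted_cofactor_pp:
  assumes x: "x \<in> \<Omega>"
  shows "partial p (partial p (weighted_cofactor \<theta> p p)) x = K * ((2 - \<alpha>) * (1 - \<alpha>)) * monomial (- \<alpha>) (- \<beta>) x"
proof (rule partial_partial_eqI[OF open_\<Omega> x weighted_cofactor_entries(1)])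
  show "((\<lambda>t. K * monomial (2 - \<alpha>) (- \<beta>) (shift p y t)) has_real_derivative
      K * (2 - \<alpha>) * monomial (1 - \<alpha>) (- \<beta>) y) (at 0)" if "y \<in> \<Omega>" for y
    by (rule derivative_eq_intros monomial_shift_derivative[OF that] refl | simp add: \<rho>'_simps)+
  show "((\<lambda>t. K * (2 - \<alpha>) * monomial (1 - \<alpha>) (- \<beta>) (shift p x t)) has_real_derivative
      K * ((2 - \<alpha>) * (1 - \<alpha>)) * monomial (- \<alpha>) (- \<beta>) x) (at 0)"
    by (rule derivative_eq_intros monomial_shift_derivative[OF x] refl | simp add: \<rho>'_simps)+
qed

lemma partial_weighted_cofactor_qq:
  assumes x: "x \<in> \<Omega>"
  shows "partial q (partial q (weighted_cofactor \<theta> q q)) x = K / b * (1 - \<beta>) *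
    ((2 - \<beta>) * monomial (- \<alpha>) (- \<beta>) x - \<beta> * sq x * monomial (- \<alpha>) (- \<beta> - 1) x)"
proof (rule partial_partial_eqI[OF open_\<Omega> x weighted_cofactor_entries(2)])
  show "((\<lambda>t. K / b * (monomial (- \<alpha>) (2 - \<beta>) (shift q y t)
        + sq (shift q y t) * monomial (- \<alpha>) (1 - \<beta>) (shift q y t))) has_real_derivative
      K / b * ((2 - \<beta>) * monomial (- \<alpha>) (1 - \<beta>) y + (1 - \<beta>) * (sq y * monomial (- \<alpha>) (- \<beta>) y))) (at 0)"
    if "y \<in> \<Omega>" for y
    by (rule derivative_eq_intros sq_shift_derivative monomial_shift_derivative[OF that] refl
        | simp add: \<rho>'_simps)+
  show "((\<lambda>t. K / b * ((2 - \<beta>) * monomial (- \<alpha>) (1 - \<beta>) (shift q x t)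
        + (1 - \<beta>) * (sq (shift q x t) * monomial (- \<alpha>) (- \<beta>) (shift q x t)))) has_real_derivative
      K / b * (1 - \<beta>) *
    ((2 - \<beta>) * monomial (- \<alpha>) (- \<beta>) x - \<beta> * sq x * monomial (- \<alpha>) (- \<beta> - 1) x)) (at 0)"
    by (rule derivative_eq_intros sq_shift_derivative monomial_shift_derivative[OF x] refl
        | simp add: \<rho>'_simps)+ (simp add: algebra_simps)
qed

lemma partial_weighted_cofactor_rr:
  assumes x: "x \<in> \<Omega>" and r: "r \<in> R"
  shows "partial r (partial r (weighted_cofactor \<theta> r r)) x = - (K / b * (1 - \<beta>) *
    (monomial (- \<alpha>) (- \<beta>) x + \<beta> * (x $ r)\<^sup>2 * monomial (- \<alpha>) (- \<beta> - 1) x))"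
proof (rule partial_partial_eqI[OF open_\<Omega> x weighted_cofactor_entries(3)[OF _ r]])
  note [simp] = R_neq[OF r]
  show "((\<lambda>t. K / b * monomial (- \<alpha>) (1 - \<beta>) (shift r y t)) has_real_derivative
      K / b * (- (1 - \<beta>) * (y $ r * monomial (- \<alpha>) (- \<beta>) y))) (at 0)"
    if "y \<in> \<Omega>" for y
    by (rule derivative_eq_intros monomial_shift_derivative[OF that] refl
        | simp add: \<rho>'_simps r)+ (simp add: algebra_simps diff_divide_distrib)
  show "((\<lambda>t. K / b * (- (1 - \<beta>) * (shift r x t $ r * monomial (- \<alpha>) (- \<beta>) (shift r x t)))) has_real_derivative
     - (K / b * (1 - \<beta>) *
    (monomial (- \<alpha>) (- \<beta>) x + \<beta> * (x $ r)\<^sup>2 * monomial (- \<alpha>) (- \<beta> - 1) x))) (at 0)"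
    by (rule derivative_eq_intros nth_shift_derivative monomial_shift_derivative[OF x] refl)+
      (simp add: \<rho>'_simps r power2_eq_square algebra_simps add_divide_distrib diff_divide_distrib)
qed

lemma partial_weighted_cofactor_rq:
  assumes x: "x \<in> \<Omega>" and r: "r \<in> R"
  shows "partial r (partial q (weighted_cofactor \<theta> r q)) x = K / b * (1 - \<beta>) *
    (monomial (- \<alpha>) (- \<beta>) x + \<beta> * (x $ r)\<^sup>2 * monomial (- \<alpha>) (- \<beta> - 1) x)"
proof (rule partial_partial_eqI[OF open_\<Omega> x weighted_cofactor_entries(4)[OF _ r]])
  note [simp] = R_neq[OF r]
  show "((\<lambda>t. K / b * (shift q y t $ r * monomial (- \<alpha>) (1 - \<beta>) (shift q y t))) has_real_derivative
      K / b * ((1 - \<beta>) * (y $ r * monomial (- \<alpha>) (- \<beta>) y))) (at 0)"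
    if "y \<in> \<Omega>" for y
    by (rule derivative_eq_intros nth_shift_derivative monomial_shift_derivative[OF that] refl)+
      (simp add: \<rho>'_simps)
  show "((\<lambda>t. K / b * ((1 - \<beta>) * (shift r x t $ r * monomial (- \<alpha>) (- \<beta>) (shift r x t)))) has_real_derivative
     K / b * (1 - \<beta>) *
    (monomial (- \<alpha>) (- \<beta>) x + \<beta> * (x $ r)\<^sup>2 * monomial (- \<alpha>) (- \<beta> - 1) x)) (at 0)"
    by (rule derivative_eq_intros nth_shift_derivative monomial_shift_derivative[OF x] refl)+
      (simp add: \<rho>'_simps r power2_eq_square algebra_simps add_divide_distrib diff_divide_distrib)
qed

lemma partial_weighted_cofactor_qr:
  assumes x: "x \<in> \<Omega>" and r: "r \<in> R"
  shows "partial q (partial r (weighted_cofactor \<theta> q r)) x = K / b * (1 - \<beta>) *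
    (monomial (- \<alpha>) (- \<beta>) x + \<beta> * (x $ r)\<^sup>2 * monomial (- \<alpha>) (- \<beta> - 1) x)"
proof (rule partial_partial_eqI[OF open_\<Omega> x weighted_cofactor_entries(5)[OF _ r]])
  note [simp] = R_neq[OF r]
  show "((\<lambda>t. K / b * (shift r y t $ r * monomial (- \<alpha>) (1 - \<beta>) (shift r y t))) has_real_derivative
      K / b * (monomial (- \<alpha>) (1 - \<beta>) y - (1 - \<beta>) * ((y $ r)\<^sup>2 * monomial (- \<alpha>) (- \<beta>) y))) (at 0)"
    if "y \<in> \<Omega>" for y
    by (rule derivative_eq_intros nth_shift_derivative monomial_shift_derivative[OF that] refl)+
      (simp add: \<rho>'_simps r power2_eq_square algebra_simps add_divide_distrib diff_divide_distrib)
  show "((\<lambda>t. K / b * (monomial (- \<alpha>) (1 - \<beta>) (shift q x t)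
        - (1 - \<beta>) * ((shift q x t $ r)\<^sup>2 * monomial (- \<alpha>) (- \<beta>) (shift q x t)))) has_real_derivative
     K / b * (1 - \<beta>) *
    (monomial (- \<alpha>) (- \<beta>) x + \<beta> * (x $ r)\<^sup>2 * monomial (- \<alpha>) (- \<beta> - 1) x)) (at 0)"
    by (rule derivative_eq_intros nth_shift_derivative monomial_shift_derivative[OF x] refl)+
      (simp add: \<rho>'_simps r power2_eq_square algebra_simps add_divide_distrib diff_divide_distrib)
qed

text \<open>The terms with $x_r^2 \rho^{- \beta - 1}$ cancel: each \<open>r \<in> R\<close> contributes two equal mixed
  second derivatives and a diagonal one that is their negative, and the surplus is absorbed by the
  $(q, q)$ term.
  The bracket that is left is $b \lambda_1 + b \lambda_2$, since $2 - \alpha = 2 \theta$ and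
  $1 - \beta = N \theta - (N - 1)$.\<close>

lemma sum_partial_weighted_cofactor:
  assumes x: "x \<in> \<Omega>"
  shows "(\<Sum>i\<in>UNIV. \<Sum>j\<in>UNIV. partial i (partial j (weighted_cofactor \<theta> i j)) x)
    = K / b * monomial (- \<alpha>) (- \<beta>) x * (b * ((2 - \<alpha>) * (1 - \<alpha>)) + (1 - \<beta>) * (real (card R) + 2 - \<beta>))"
proof -
  define T where "T i j = partial i (partial j (weighted_cofactor \<theta> i j)) x" for i j
  define m m' where "m = monomial (- \<alpha>) (- \<beta>) x" and "m' = monomial (- \<alpha>) (- \<beta> - 1) x"
  define c where "c r = K / b * (1 - \<beta>) * (m + \<beta> * (x $ r)\<^sup>2 * m')" for r
  have zero: "T i j = 0" if "i \<noteq> j" "i = p \<or> j = p \<or> i \<in> R \<and> j \<in> R" for i j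
    unfolding T_def using partial_weighted_cofactor_zero[OF that x] .
  have R: "T r q = c r" "T q r = c r" "T r r = - c r" if "r \<in> R" for r
    using partial_weighted_cofactor_rq[OF x that] partial_weighted_cofactor_qr[OF x that] partial_weighted_cofactor_rr[OF x that]
    by (simp_all add: T_def c_def m_def m'_def)
  have inner: "(\<Sum>s\<in>R. T r s) = - c r" if "r \<in> R" for r
  proof -
    have "(\<Sum>s\<in>R. T r s) = (\<Sum>s\<in>R. if s = r then - c r else 0)"
      using that by (intro sum.cong) (auto simp: R zero)
    then show ?thesis using that by simp
  qed
  have zR: "T p r = 0" "T r p = 0" if "r \<in> R" for r
    using R_neq[OF that] by (simp_all add: zero)
  have "(\<Sum>i\<in>UNIV. \<Sum>j\<in>UNIV. T i j) = T p p + T q q + (\<Sum>r\<in>R. c r)"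
    using p_neq_q by (simp add: UNIV_split zero zR R inner)
  also have "(\<Sum>r\<in>R. c r) = K / b * (1 - \<beta>) * (real (card R) * m + \<beta> * sq x * m')"
    by (simp add: c_def sq_def sum.distrib sum_distrib_left sum_distrib_right algebra_simps)
  also have "T p p = K / b * (b * ((2 - \<alpha>) * (1 - \<alpha>))) * m"
    using partial_weighted_cofactor_pp[OF x] b_pos by (simp add: T_def m_def)
  also have "T q q = K / b * (1 - \<beta>) * ((2 - \<beta>) * m - \<beta> * sq x * m')"
    using partial_weighted_cofactor_qq[OF x] by (simp add: T_def m_def m'_def)
  finally show ?thesis
    unfolding T_def m_def[symmetric] using b_pos
    by (simp add: algebra_simps add_divide_distrib diff_divide_distrib)
qed

end

lemma affine_maximal_u:
  assumes "b * (2 * (2 * \<theta> - 1)) = real CARD('n) * (real CARD('n) - 1 - real CARD('n) * \<theta>)"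
  shows "affine_maximal_type_on \<theta> \<Omega> u"
proof -
  have "2 \<le> CARD('n)"
    using card_mono[of "UNIV :: 'n set" "{p, q}"] p_neq_q by simp
  then have N: "real (card R) = real CARD('n) - 2" by (simp add: card_R)
  have "b * ((2 - 2 * (1 - \<theta>)) * (1 - 2 * (1 - \<theta>)))
      + (1 - real CARD('n) * (1 - \<theta>)) * (real (card R) + 2 - real CARD('n) * (1 - \<theta>))
    = \<theta> * (b * (2 * (2 * \<theta> - 1)) - real CARD('n) * (real CARD('n) - 1 - real CARD('n) * \<theta>))"
    unfolding N by (simp add: algebra_simps)
  then have "b * ((2 - 2 * (1 - \<theta>)) * (1 - 2 * (1 - \<theta>)))
      + (1 - real CARD('n) * (1 - \<theta>)) * (real (card R) + 2 - real CARD('n) * (1 - \<theta>)) = 0"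
    using assms by simp
  moreover have "(\<lambda>y. cofactor_matrix (hessian u y) $ i $ j * affine_weight \<theta> u y) = weighted_cofactor \<theta> i j" for i j
    by (simp add: weighted_cofactor_def fun_eq_iff)
  ultimately show ?thesis
    unfolding affine_maximal_type_on_def
    using sum_partial_weighted_cofactor[OF refl refl refl, of _ \<theta>] by simp
qed

end

theorem theoremB:
  fixes \<theta> :: real
  assumes "CARD('n::finite) \<ge> 3"
    and "1 / 2 < \<theta>" and "\<theta> < (real CARD('n) - 1) / real CARD('n)"
  shows "\<exists>(\<Omega> :: (real ^ 'n) set) (u :: real ^ 'n \<Rightarrow> real).
    open \<Omega> \<and> convex \<Omega> \<and> \<Omega> \<noteq> {} \<and>
    Ck_on 5 u \<Omega> \<and>
    \<not> quadratic_on \<Omega> u \<and>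
    locally_uniformly_convex_on \<Omega> u \<and>
    affine_maximal_type_on \<theta> \<Omega> u \<and>
    (\<forall>z\<in>frontier \<Omega>. filterlim u at_top (at z within \<Omega>))"
proof -
  obtain p q :: 'n where pq: "p \<noteq> q"
    using assms(1) card_le_Suc0_iff_eq[of "UNIV :: 'n set"] by fastforce
  define b where "b = real CARD('n) * (real CARD('n) - 1 - real CARD('n) * \<theta>) / (2 * (2 * \<theta> - 1))"
  have "real CARD('n) * \<theta> < real CARD('n) - 1"
    using assms(1,3) by (simp add: field_simps)
  then have "0 < b"
    using assms(1,2) by (simp add: b_def)
  then interpret log_potential p q b
    using pq by unfold_locales
  have "b * (2 * (2 * \<theta> - 1)) = real CARD('n) * (real CARD('n) - 1 - real CARD('n) * \<theta>)"
    using assms(2) by (simp add: b_def)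
  from affine_maximal_u[OF this] show ?thesis
    using open_\<Omega> convex_\<Omega> coordinate_plane_mem_\<Omega>(1)[of 1] Ck_on_u not_quadratic_u
      positive_definite_hessian_u u_at_frontier
    unfolding locally_uniformly_convex_on_def
    by (intro exI[of _ \<Omega>] exI[of _ u]) auto
qed

end
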